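(* Let $\mathcal{S}_+^3$ be the cone of $3\times 3$ real symmetric positive semidefinite matrices. If $K=K_1\times\cdots\times K_m$ is a finite Cartesian product of smooth convex cones $K_1,\ldots,K_m$ (for any positive integer $m$), then $\mathcal{S}_+^3$ does not have a $K$-lift.
   Context: Lift: if $C\subseteq\mathbb{R}^n$ and $K\subseteq\mathbb{R}^d$ are closed convex cones, $C$ has a $K$-lift if $C=\pi(K\cap L)$ for some linear map $\pi:\mathbb{R}^d\to\mathbb{R}^n$ and some linear subspace $L\subseteq\mathbb{R}^d$. Here the space of $3\times 3$ real symmetric matrices is identified with $\mathbb{R}^6$. A face of a closed convex cone $K$ is a convex subset $F\subseteq K$ such that whenever $x,y\in K$ and $\alpha x+(1-\alpha)y\in F$ for some $\alpha\in(0,1)$, then $x,y\in F$. An extreme ray is a face of the form $\mathbb{R}_+v$ with $v\neq 0$. A pointed (i.e. $K\cap(-K)=\{0\}$) closed convex cone $K$, in some finite-dimensional real vector space, is called smooth if its only nonempty faces are $\{0\}$, $K$ itself, and its extreme rays. *)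

theory Defs
  imports "HOL-Analysis.Analysis"
begin

(* A finite-dimensional real vector space is a subspace of a Euclidean space type. *)

definition ray :: "'a::real_vector \<Rightarrow> 'a set" where
  "ray v = {c *\<^sub>R v |c. 0 \<le> c}"

definition extreme_ray_of :: "'a::real_vector set \<Rightarrow> 'a set \<Rightarrow> bool"
    (infix "extreme'_ray'_of" 50) where
  "F extreme_ray_of K \<longleftrightarrow> F face_of K \<and> (\<exists>v. v \<noteq> 0 \<and> F = ray v)"

(* The library predicate cone also holds of the empty set; pointedness puts 0 in K. *)

definition pointed :: "'a::real_vector set \<Rightarrow> bool" where
  "pointed K \<longleftrightarrow> K \<inter> uminus ` K = {0}"

definition smooth_cone :: "'a::euclidean_space set \<Rightarrow> bool" where
  "smooth_cone K \<longleftrightarrow>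
     closed K \<and> convex K \<and> cone K \<and> pointed K \<and>
     (\<forall>F. F face_of K \<and> F \<noteq> {} \<longrightarrow> F = {0} \<or> F = K \<or> F extreme_ray_of K)"

definition cart_prod :: "('m \<Rightarrow> 'a set) \<Rightarrow> ('a ^ 'm::finite) set" where
  "cart_prod K = {x. \<forall>i. x $ i \<in> K i}"

(* C is a cone in the space V, K a cone in the space W. A linear map from W to V is
   represented by a linear map on the whole type that sends W into V; this is no
   restriction, since every linear map on a subspace extends to the whole space. *)

definition has_lift ::
    "'b::euclidean_space set \<Rightarrow> 'b set \<Rightarrow> 'a::euclidean_space set \<Rightarrow> 'a set \<Rightarrow> bool" where
  "has_lift V C W K \<longleftrightarrow>
     (\<exists>\<pi> L. linear \<pi> \<and> \<pi> ` W \<subseteq> V \<and> subspace L \<and> L \<subseteq> W \<and> C = \<pi> ` (K \<inter> L))"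

definition sym_matrices :: "(real ^ 'n ^ 'n) set" where
  "sym_matrices = {A. transpose A = A}"

definition psd_cone :: "(real ^ 'n::finite ^ 'n) set" where
  "psd_cone = {A \<in> sym_matrices. \<forall>x. 0 \<le> x \<bullet> (A *v x)}"

end

theory Submission
  imports Defs "HOL-Library.Ramsey"
begin

text \<open>
  The obstruction is that the moment curve makes the positive semidefinite cone 2-neighborly.
  With \<open>x\<^sub>n = (1, n, n\<^sup>2)\<close>, the matrices \<open>X\<^sub>n = x\<^sub>n x\<^sub>n\<^sup>T\<close> are infinitely many points of the cone
  such that any two of them, \<open>X\<^sub>i\<close> and \<open>X\<^sub>j\<close>, lie on a face containing no further \<open>X\<^sub>k\<close>: the
  face on which the quadratic form takes the value \<open>0\<close> at the coefficient vector of the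
  polynomial \<open>(s - i) (s - j)\<close>.

  A product of smooth cones cannot reproduce this pattern. Suppose that \<open>\<pi>\<close> is a lift and pick
  preimages \<open>z\<^sub>n\<close> of the \<open>X\<^sub>n\<close>. In a single smooth factor, two points either generate the
  whole factor as a face, or they share a proper face, which for a nonzero point can only be
  its own ray. By Ramsey's theorem one may pass to infinitely many indices for which the same
  alternative holds for all pairs, and then every face containing two of the points contains
  all of them (\<open>smooth_cone_homogeneous\<close>). Doing this for each of the finitely many factors in
  turn yields three indices \<open>i, j, k\<close> such that, in every factor, \<open>z\<^sub>k\<close> lies in the smallest face
  containing \<open>z\<^sub>i + z\<^sub>j\<close>. By \<open>generated_face\<close> this says that \<open>z\<^sub>i + z\<^sub>j - e z\<^sub>k\<close> is in the product
  for some \<open>e > 0\<close>. Applying \<open>\<pi>\<close>, the matrix \<open>X\<^sub>i + X\<^sub>j - e X\<^sub>k\<close> is positive semidefinite, which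
  contradicts the choice of the \<open>X\<^sub>n\<close>.
\<close>

section \<open>Faces of convex cones\<close>

lemma convex_cone_add:
  assumes "convex K" "cone K" "x \<in> K" "y \<in> K"
  shows "x + y \<in> K"
  using assms convex_cone[of K] by blast

lemma pointed_zero: "pointed K \<Longrightarrow> 0 \<in> K"
  unfolding pointed_def by blast

lemma minus_scaleR_mono:
  assumes K: "convex K" "cone K" and "x \<in> K" and w: "w - e *\<^sub>R x \<in> K" and "d \<le> e"
  shows "w - d *\<^sub>R x \<in> K"
proof -
  have "(e - d) *\<^sub>R x \<in> K"
    using K(2) \<open>x \<in> K\<close> \<open>d \<le> e\<close> by (simp add: cone_def)
  from convex_cone_add[OF K w this] show ?thesis
    by (simp add: algebra_simps)
qed

text \<open>
  For \<open>w \<in> K\<close> the set below is the smallest face of \<open>K\<close> containing \<open>w\<close>. Describing it by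
  the order that \<open>K\<close> induces, rather than as an intersection of faces, turns membership in
  the face into membership of a linear combination in \<open>K\<close>, which a linear map can transport.
\<close>

lemma generated_face:
  assumes K: "convex K" "cone K"
  shows "{x \<in> K. \<exists>e>0. w - e *\<^sub>R x \<in> K} face_of K" (is "?F face_of K")
  unfolding face_of_def
proof (intro conjI ballI impI)
  show "?F \<subseteq> K" by blast
  show "convex ?F"
  proof (rule convexI)
    fix x y :: 'a and u v :: real
    assume x: "x \<in> ?F" and y: "y \<in> ?F" and uv: "0 \<le> u" "0 \<le> v" "u + v = 1"
    obtain d e where d: "d > 0" "w - d *\<^sub>R x \<in> K" and e: "e > 0" "w - e *\<^sub>R y \<in> K"
      using x y by blast
    define c where "c = min d e"
    have "w - c *\<^sub>R x \<in> K" "w - c *\<^sub>R y \<in> K"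
      using minus_scaleR_mono[OF K _ d(2), of c] minus_scaleR_mono[OF K _ e(2), of c] x y
      by (auto simp: c_def)
    then have "u *\<^sub>R (w - c *\<^sub>R x) + v *\<^sub>R (w - c *\<^sub>R y) \<in> K"
      using K(1) uv by (simp add: convex_def)
    moreover have "u *\<^sub>R (w - c *\<^sub>R x) + v *\<^sub>R (w - c *\<^sub>R y)
        = (u + v) *\<^sub>R w - c *\<^sub>R (u *\<^sub>R x + v *\<^sub>R y)"
      by (simp add: algebra_simps)
    moreover have "c > 0" using d e by (simp add: c_def)
    moreover have "u *\<^sub>R x + v *\<^sub>R y \<in> K"
      using K(1) uv x y by (simp add: convex_def)
    ultimately show "u *\<^sub>R x + v *\<^sub>R y \<in> ?F"
      using uv by auto
  qed
next
  have endpoint: "a \<in> ?F"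
    if ab: "a \<in> K" "b \<in> K" and x: "x \<in> ?F" "x \<in> open_segment a b" for a b x
  proof -
    obtain u where u: "0 < u" "u < 1" "x = (1 - u) *\<^sub>R a + u *\<^sub>R b"
      using x(2) by (auto simp: in_segment)
    obtain e where e: "e > 0" "w - e *\<^sub>R x \<in> K"
      using x(1) by blast
    have "(e * u) *\<^sub>R b \<in> K"
      using K(2) ab(2) u e by (simp add: cone_def)
    from convex_cone_add[OF K e(2) this] have "w - (e * (1 - u)) *\<^sub>R a \<in> K"
      by (simp add: u(3) algebra_simps)
    moreover have "e * (1 - u) > 0" using u e by simp
    ultimately show ?thesis using ab(1) by blast
  qed
  fix a b x
  assume *: "a \<in> K" "b \<in> K" "x \<in> ?F" "x \<in> open_segment a b"
  show "a \<in> ?F" using endpoint * by blast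
  show "b \<in> ?F" using endpoint[of b a x] * by (simp add: open_segment_commute)
qed

lemma face_of_cone_summand:
  assumes K: "cone K" and F: "F face_of K" and xy: "x \<in> K" "y \<in> K" "x + y \<in> F"
  shows "x \<in> F"
proof -
  have conic: "c *\<^sub>R a \<in> F" if "a \<in> F" "0 \<le> c" for a c
    using face_of_conic[OF _ F] K that by (auto simp: conic_def cone_def)
  \<comment> \<open>The sum is the midpoint of \<open>2 x\<close> and \<open>2 y\<close>; their open segment is empty if \<open>x = y\<close>.\<close>
  show ?thesis
  proof (cases "x = y")
    case True
    then have "x = (1/2) *\<^sub>R (x + y)"
      by (simp add: scaleR_2[symmetric])
    then show ?thesis using conic[OF xy(3), of "1/2"] by simp
  next
    case False
    have "2 *\<^sub>R x \<in> K" "2 *\<^sub>R y \<in> K"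
      using K xy by (simp_all add: cone_def)
    moreover have "x + y \<in> open_segment (2 *\<^sub>R x) (2 *\<^sub>R y)"
      unfolding in_segment using False by (intro conjI exI[of _ "1/2"]) simp_all
    ultimately have "2 *\<^sub>R x \<in> F"
      using face_ofD[OF F] xy by blast
    from conic[OF this, of "1/2"] show ?thesis by simp
  qed
qed

lemma smooth_cone_proper_face:
  assumes K: "smooth_cone K" and F: "F face_of K" "F \<noteq> K" and x: "x \<in> F" "x \<noteq> 0"
  shows "F = ray x"
proof -
  obtain v where v: "F = ray v"
    using K F x by (auto simp: smooth_cone_def extreme_ray_of_def)
  then obtain c where c: "0 \<le> c" "x = c *\<^sub>R v"
    using x(1) by (auto simp: ray_def)
  with x(2) have "c > 0" by (cases "c = 0") auto
  have "\<exists>b\<ge>0. a *\<^sub>R v = b *\<^sub>R x" if "a \<ge> 0" for a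
    using that \<open>c > 0\<close> c by (intro exI[of _ "a / c"]) simp
  moreover have "\<exists>b\<ge>0. a *\<^sub>R x = b *\<^sub>R v" if "a \<ge> 0" for a
    using that c by (intro exI[of _ "a * c"]) simp
  ultimately show ?thesis unfolding v ray_def by auto
qed

section \<open>Ramsey's theorem in products of smooth cones\<close>

text \<open>
  Ramsey's theorem is applied to the pairs of indices, coloured by whether the two points share
  a proper face. If no pair does, then each pair generates all of \<open>K\<close>. If every pair does, then
  all points lie on one ray, provided that they are nonzero. The zero points have to be
  separated first, since \<open>0\<close> shares a proper face with points on different rays.
\<close>

lemma smooth_cone_homogeneous:
  fixes z :: "nat \<Rightarrow> 'a::euclidean_space"
  assumes K: "smooth_cone K" and z: "\<And>n. z n \<in> K" and I: "infinite I"
  obtains J where "J \<subseteq> I" "infinite J"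
    "\<And>i j k F. \<lbrakk>i \<in> J; j \<in> J; k \<in> J; i \<noteq> j; F face_of K; z i + z j \<in> F\<rbrakk> \<Longrightarrow> z k \<in> F"
proof (cases "infinite {n \<in> I. z n = 0}")
  case True
  show ?thesis by (rule that[OF _ True]) auto
next
  case False
  have cone: "cone K" using K by (simp add: smooth_cone_def)
  define I' where "I' = {n \<in> I. z n \<noteq> 0}"
  have "I = I' \<union> {n \<in> I. z n = 0}" by (auto simp: I'_def)
  then have I': "infinite I'" using False I by (metis finite_UnI)
  define share where "share e \<longleftrightarrow> (\<exists>F. F face_of K \<and> F \<noteq> K \<and> z ` e \<subseteq> F)" for e
  define col :: "nat set \<Rightarrow> nat" where "col e = (if share e then 1 else 0)" for e
  have "\<forall>i\<in>I'. \<forall>j\<in>I'. i \<noteq> j \<longrightarrow> col {i, j} < 2"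
    by (simp add: col_def)
  from Ramsey2[OF I' this] obtain J t where J: "J \<subseteq> I'" "infinite J"
    and hom: "\<And>i j. \<lbrakk>i \<in> J; j \<in> J; i \<noteq> j\<rbrakk> \<Longrightarrow> col {i, j} = t"
    by metis
  show ?thesis
  proof (rule that[OF _ J(2)])
    show "J \<subseteq> I" using J(1) by (auto simp: I'_def)
  next
    fix i j k F
    assume ijk: "i \<in> J" "j \<in> J" "k \<in> J" "i \<noteq> j" and F: "F face_of K" "z i + z j \<in> F"
    have i: "z i \<in> F" and j: "z j \<in> F"
      using face_of_cone_summand[OF cone F(1) z z, of i j]
        face_of_cone_summand[OF cone F(1) z z, of j i] F(2)
      by (simp_all add: add.commute)
    show "z k \<in> F"
    proof (cases "F = K")
      case True
      then show ?thesis by (simp add: z)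
    next
      case False
      show ?thesis
      proof (cases "k = i")
        case True
        then show ?thesis using i by simp
      next
        case False
        have "share {i, j}"
          unfolding share_def using F(1) \<open>F \<noteq> K\<close> i j by auto
        with hom ijk False have "share {i, k}"
          by (metis col_def zero_neq_one)
        then obtain G where G: "G face_of K" "G \<noteq> K" "z i \<in> G" "z k \<in> G"
          by (auto simp: share_def)
        have "z i \<noteq> 0" using ijk J by (auto simp: I'_def)
        with smooth_cone_proper_face[OF K] F(1) \<open>F \<noteq> K\<close> i G have "F = G"
          by metis
        then show ?thesis using G by simp
      qed
    qed
  qed
qed

lemma smooth_cones_homogeneous:
  fixes K :: "'m \<Rightarrow> 'a::euclidean_space set" and z :: "nat \<Rightarrow> 'm \<Rightarrow> 'a"
  assumes "finite T" and K: "\<And>t. smooth_cone (K t)" and z: "\<And>n t. z n t \<in> K t"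
  shows "\<exists>J. infinite J \<and> (\<forall>t\<in>T. \<forall>i\<in>J. \<forall>j\<in>J. \<forall>k\<in>J. \<forall>F.
    i \<noteq> j \<longrightarrow> F face_of K t \<longrightarrow> z i t + z j t \<in> F \<longrightarrow> z k t \<in> F)"
  using \<open>finite T\<close>
proof (induction T)
  case empty
  show ?case using infinite_UNIV_nat by auto
next
  case (insert s T)
  obtain I where I: "infinite I" "\<forall>t\<in>T. \<forall>i\<in>I. \<forall>j\<in>I. \<forall>k\<in>I. \<forall>F.
      i \<noteq> j \<longrightarrow> F face_of K t \<longrightarrow> z i t + z j t \<in> F \<longrightarrow> z k t \<in> F"
    using insert.IH by (elim exE conjE)
  show ?case
  proof (rule smooth_cone_homogeneous[OF K, of "\<lambda>n. z n s", OF z I(1)], goal_cases)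
    case (1 J)
    show ?case
    proof (intro exI[of _ J] conjI ballI allI impI)
      show "infinite J" by (fact 1)
    next
      fix t i j k F
      assume t: "t \<in> insert s T" and ijk: "i \<in> J" "j \<in> J" "k \<in> J" "i \<noteq> j"
        and F: "F face_of K t" "z i t + z j t \<in> F"
      show "z k t \<in> F"
      proof (cases "t = s")
        case True
        then show ?thesis using 1(3)[OF ijk] F by simp
      next
        case False
        with t have "t \<in> T" by simp
        moreover have "i \<in> I" "j \<in> I" "k \<in> I"
          using ijk 1(1) by (simp_all add: subsetD)
        ultimately show ?thesis using I(2)[rule_format] ijk(4) F by simp
      qed
    qed
  qed
qed

text \<open>
  Each factor gives its own positive multiple of the third point that can be subtracted; as
  there are finitely many factors, the least of these serves for the whole product.
\<close>

lemma smooth_product_dominates: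
  fixes K :: "'m::finite \<Rightarrow> 'a::euclidean_space set" and z :: "nat \<Rightarrow> 'a ^ 'm"
  assumes K: "\<And>t. smooth_cone (K t)" and z: "\<And>n. z n \<in> cart_prod K"
  obtains i j k e where "i \<noteq> j" "k \<noteq> i" "k \<noteq> j" "0 < e" "z i + z j - e *\<^sub>R z k \<in> cart_prod K"
proof -
  have zK: "z n $ t \<in> K t" for n t
    using z by (simp add: cart_prod_def)
  obtain J where J: "infinite J" "\<forall>t\<in>UNIV. \<forall>i\<in>J. \<forall>j\<in>J. \<forall>k\<in>J. \<forall>F.
      i \<noteq> j \<longrightarrow> F face_of K t \<longrightarrow> z i $ t + z j $ t \<in> F \<longrightarrow> z k $ t \<in> F"
    using smooth_cones_homogeneous[of UNIV K "\<lambda>n t. z n $ t", OF finite K zK] by (elim exE conjE)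
  obtain B where "B \<subseteq> J" "card B = 3"
    using infinite_arbitrarily_large[OF J(1)] by metis
  then obtain i j k where ijk: "i \<in> J" "j \<in> J" "k \<in> J" "i \<noteq> j" "k \<noteq> i" "k \<noteq> j"
    by (auto simp: card_3_iff)
  have "\<exists>d>0. z i $ t + z j $ t - d *\<^sub>R z k $ t \<in> K t" for t
  proof -
    have Kt: "convex (K t)" "cone (K t)" "0 \<in> K t"
      using K[of t] pointed_zero by (auto simp: smooth_cone_def)
    let ?w = "z i $ t + z j $ t"
    have "?w \<in> K t" using convex_cone_add[OF Kt(1,2)] zK by blast
    then have "?w \<in> {x \<in> K t. \<exists>d>0. ?w - d *\<^sub>R x \<in> K t}"
      using Kt(3) by (auto intro!: exI[of _ 1])
    then have "z k $ t \<in> {x \<in> K t. \<exists>d>0. ?w - d *\<^sub>R x \<in> K t}"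
      using J(2)[rule_format, OF UNIV_I ijk(1-4) generated_face[OF Kt(1,2), of ?w]] by simp
    then show ?thesis by simp
  qed
  then obtain d where d: "\<And>t. d t > 0" "\<And>t. z i $ t + z j $ t - d t *\<^sub>R z k $ t \<in> K t"
    by metis
  define e where "e = Min (range d)"
  have "e > 0" using d(1) by (auto simp: e_def)
  have "z i $ t + z j $ t - e *\<^sub>R z k $ t \<in> K t" for t
  proof (rule minus_scaleR_mono[OF _ _ zK d(2)])
    show "convex (K t)" "cone (K t)" using K[of t] by (auto simp: smooth_cone_def)
    show "e \<le> d t" by (simp add: e_def)
  qed
  then have "z i + z j - e *\<^sub>R z k \<in> cart_prod K"
    by (simp add: cart_prod_def)
  with that ijk \<open>e > 0\<close> show thesis by blast
qed

section \<open>The moment curve\<close>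

definition moment_matrix :: "nat \<Rightarrow> real ^ 3 ^ 3" where
  "moment_matrix n = (\<chi> a b. let x = vector [1, real n, (real n)\<^sup>2] :: real ^ 3 in x $ a * x $ b)"

lemma moment_matrix_quadratic_form:
  "y \<bullet> (moment_matrix n *v y) = (y $ 1 + y $ 2 * real n + y $ 3 * (real n)\<^sup>2)\<^sup>2"
  by (simp add: moment_matrix_def inner_vec_def matrix_vector_mult_def sum_3
      power2_eq_square algebra_simps)

lemma moment_matrix_psd: "moment_matrix n \<in> psd_cone"
  unfolding psd_cone_def
  by (auto simp: moment_matrix_quadratic_form)
    (simp add: sym_matrices_def transpose_def moment_matrix_def vec_eq_iff Let_def)

text \<open>
  The quadratic form of \<open>X\<^sub>n\<close> at a coefficient vector is the squared value at \<open>n\<close> of the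
  polynomial, so the polynomial with roots \<open>i\<close> and \<open>j\<close> separates \<open>X\<^sub>k\<close> from \<open>X\<^sub>i\<close> and \<open>X\<^sub>j\<close>.
\<close>

lemma moment_matrices_not_dominate:
  assumes "k \<noteq> i" "k \<noteq> j" "0 < e"
  shows "moment_matrix i + moment_matrix j - e *\<^sub>R moment_matrix k \<notin> psd_cone"
proof
  assume "moment_matrix i + moment_matrix j - e *\<^sub>R moment_matrix k \<in> psd_cone"
  then have pos: "0 \<le> y \<bullet> ((moment_matrix i + moment_matrix j - e *\<^sub>R moment_matrix k) *v y)" for y
    by (simp add: psd_cone_def)
  define y :: "real ^ 3" where "y = vector [real i * real j, - (real i + real j), 1]"
  have form: "y \<bullet> (moment_matrix n *v y) = ((real n - real i) * (real n - real j))\<^sup>2" for n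
    unfolding moment_matrix_quadratic_form
    by (rule arg_cong[where f = "\<lambda>x. x\<^sup>2"]) (simp add: y_def power2_eq_square algebra_simps)
  have "y \<bullet> ((moment_matrix i + moment_matrix j - e *\<^sub>R moment_matrix k) *v y)
      = - e * ((real k - real i) * (real k - real j))\<^sup>2"
    by (simp add: matrix_vector_mult_add_rdistrib matrix_vector_mult_diff_rdistrib
        scaleR_matrix_vector_assoc[symmetric] inner_add_right inner_diff_right form)
  moreover have "((real k - real i) * (real k - real j))\<^sup>2 > 0"
    using assms by simp
  ultimately show False
    using pos[of y] \<open>0 < e\<close> by (simp add: mult_le_0_iff zero_le_mult_iff)
qed

theorem mainTheorem2:
  fixes V K :: "'m::finite \<Rightarrow> 'a::euclidean_space set"
  assumes "\<And>i. subspace (V i)"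
    and "\<And>i. K i \<subseteq> V i"
    and "\<And>i. smooth_cone (K i)"
  shows "\<not> has_lift (sym_matrices :: (real ^ 3 ^ 3) set) psd_cone (cart_prod V) (cart_prod K)"
proof
  assume "has_lift (sym_matrices :: (real ^ 3 ^ 3) set) psd_cone (cart_prod V) (cart_prod K)"
  then obtain \<pi> :: "'a ^ 'm \<Rightarrow> real ^ 3 ^ 3" and L
    where \<pi>: "linear \<pi>" and L: "subspace L" and lift: "psd_cone = \<pi> ` (cart_prod K \<inter> L)"
    unfolding has_lift_def by blast
  have "\<exists>z. z \<in> cart_prod K \<and> z \<in> L \<and> \<pi> z = moment_matrix n" for n
    using moment_matrix_psd[of n] unfolding lift by force
  then obtain z where z: "\<And>n. z n \<in> cart_prod K" "\<And>n. z n \<in> L" "\<And>n. \<pi> (z n) = moment_matrix n"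
    by metis
  obtain i j k e where ijk: "i \<noteq> j" "k \<noteq> i" "k \<noteq> j" "0 < e"
    and dom: "z i + z j - e *\<^sub>R z k \<in> cart_prod K"
    by (rule smooth_product_dominates[of K z, OF assms(3) z(1)])
  have "z i + z j - e *\<^sub>R z k \<in> L"
    using L z(2) by (simp add: subspace_add subspace_diff subspace_scale)
  with dom have "\<pi> (z i + z j - e *\<^sub>R z k) \<in> psd_cone"
    unfolding lift by blast
  then show False
    using moment_matrices_not_dominate[OF ijk(2-4)] \<pi> z(3)
    by (simp add: linear_add linear_diff linear_scale)
qed

end
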